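(* Let $(X,d)$ be a compact metric space, let $f_n:X\to X$, $n\ge0$, be continuous maps such that $\{f_n\}_{n=0}^\infty$ is equi-continuous in $X$, let $A=(a_{ij})_{N\times N}$ be a transition matrix, let $\{V_{i,n}\}_{n=0}^\infty$, $1\le i\le N$, be sequences of nonempty closed subsets of $X$, and let $V_i$, $1\le i\le N$, be disjoint closed subsets of $X$ with $V_{i,n}\subset V_i$ for all $1\le i\le N$, $n\ge0$. Assume that the system $x_{n+1}=f_n(x_n)$ is weakly $A$-coupled-expanding in $\{V_{i,n}\}_{n=0}^\infty$, $1\le i\le N$. Then for every $n\ge0$ there exists a nonempty compact subset $\mathcal C_n\subset\bigcup_{i=1}^N\langle V_{i,n}\rangle$ of $\mathcal K(X)$ with $\bar f_n(\mathcal C_n)=\mathcal C_{n+1}$ such that the invariant subsystem of the induced set-valued system $A_{n+1}=\bar f_n(A_n)$ on $\{\mathcal C_n\}_{n=0}^\infty$ is topologically equi-semiconjugate to $(\Sigma_N^+(A),\sigma_A)$. Consequently, $h(\bar f_{0,\infty},\mathcal C_0)\ge\log\rho(A)$.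
   Context: For a sequence of maps $g_n$ of a space $Z$ into itself, $g_i^n:=g_{i+n-1}\circ\cdots\circ g_i$ for $n\ge1$, $g_i^0$ is the identity, and $g_i^{-n}:=(g_i^n)^{-1}$ (preimage). A sequence of maps $h_n:W_n\to Y$ between metric spaces, $W_n$ subsets of a common metric space, is equi-continuous in $\{W_n\}$ if for every $\epsilon>0$ there is $\delta>0$, independent of $n$, such that for all $n\ge0$ points of $W_n$ at distance less than $\delta$ have $h_n$-images at distance less than $\epsilon$; "in $X$" means $W_n=X$ for all $n$. $\mathcal K(X)$ is the set of all nonempty compact subsets of $X$ with the Hausdorff metric $\mathcal H_d(B,C):=\max\{\sup_{b\in B}d(b,C),\sup_{c\in C}d(c,B)\}$ (a compact metric space). For nonempty $K\subset X$, $\langle K\rangle:=\{B\in\mathcal K(X):B\subset K\}$; $\bar f_n:\mathcal K(X)\to\mathcal K(X)$ is $\bar f_n(B):=f_n(B)$; $\bar f_{0,\infty}:=\{\bar f_n\}_{n=0}^\infty$. In $\bar f_n(\mathcal C_n)$ the map $\bar f_n$ is applied elementwise: $\bar f_n(\mathcal C_n)=\{\bar f_n(B):B\in\mathcal C_n\}$. A transition matrix is a matrix $A=(a_{ij})_{N\times N}$, $N\ge2$, with $a_{ij}\in\{0,1\}$, $\sum_{j=1}^N a_{ij}\ge1$ for all $i$ and $\sum_{i=1}^N a_{ij}\ge1$ for all $j$. The system $x_{n+1}=f_n(x_n)$ is weakly $A$-coupled-expanding in $\{V_{i,n}\}_{n=0}^\infty$, $1\le i\le N$, if $V_{i,n}\cap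 V_{j,n}=\partial V_{i,n}\cap\partial V_{j,n}$ for all $1\le i\ne j\le N$, $n\ge0$, and $f_n(V_{i,n})\supset\bigcup_{j:\,a_{ij}=1}V_{j,n+1}$ for all $1\le i\le N$, $n\ge0$. $\Sigma_N^+(A):=\{s=(s_0,s_1,\dots):1\le s_j\le N,\ a_{s_js_{j+1}}=1,\ j\ge0\}$, with metric $\hat\rho(\alpha,\beta):=\sum_{i=0}^\infty \hat d(a_i,b_i)/2^i$ for $\alpha=(a_0,a_1,\dots)$, $\beta=(b_0,b_1,\dots)$, where $\hat d(a,b)=0$ if $a=b$ and $1$ otherwise. $\sigma_A:\Sigma_N^+(A)\to\Sigma_N^+(A)$, $\sigma_A((s_0,s_1,s_2,\dots)):=(s_1,s_2,\dots)$. $\rho(A):=\lim_{n\to\infty}\|A^n\|^{1/n}$, where $\|B\|$ denotes the sum of all entries of $B$. For subsets $\mathcal C_n\subset\mathcal K(X)$ with $\bar f_n(\mathcal C_n)\subset\mathcal C_{n+1}$ for all $n\ge0$, the set-valued system restricted to $\{\mathcal C_n\}$ is called its invariant subsystem on $\{\mathcal C_n\}_{n=0}^\infty$. It is topologically equi-semiconjugate to $(\Sigma_N^+(A),\sigma_A)$ if there are surjective maps $h_n:\mathcal C_n\to\Sigma_N^+(A)$, $n\ge0$, with $\{h_n\}$ equi-continuous in $\{\mathcal C_n\}$, such that $h_{n+1}\circ\bar f_n=\sigma_A\circ h_n$ on $\mathcal C_n$ for all $n\ge0$. Topological entropy: for a compact metric space $Z$, maps $g_n:Z\to Z$ and nonempty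 $Y\subset Z$, $h(g_{0,\infty},Y):=\sup_{\mathcal A}\limsup_{n\to\infty}\frac1n\log\mathcal N(\mathcal A_0^n|_Y)$, the supremum over open covers $\mathcal A$ of $Z$, where $\mathcal A_0^n:=\{\bigcap_{j=0}^{n-1}g_0^{-j}(A_j):A_j\in\mathcal A\}$, $\mathcal B|_Y:=\{B\cap Y:B\in\mathcal B\}$, and $\mathcal N(\cdot)$ is the minimal cardinality of a subcover. *)

theory Defs
  imports "HOL-Analysis.Analysis"
begin

section \<open>Nonautonomous systems\<close>

text \<open>\<open>iter g i n\<close> is \<open>g\<^sub>i\<^sup>n = g (i + n - 1) \<circ> \<dots> \<circ> g i\<close>.\<close>

primrec iter :: "(nat \<Rightarrow> 'z \<Rightarrow> 'z) \<Rightarrow> nat \<Rightarrow> nat \<Rightarrow> 'z \<Rightarrow> 'z" where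
  "iter g i 0 = id"
| "iter g i (Suc n) = g (i + n) \<circ> iter g i n"

text \<open>Equi-continuity of maps \<open>h n : W n \<rightarrow> Y\<close>; the two metrics are explicit arguments, since
  the hyperspace and the symbol space below are not instances of the class \<^class>\<open>metric_space\<close>.\<close>

definition equi_continuous_in ::
    "('w \<Rightarrow> 'w \<Rightarrow> real) \<Rightarrow> ('y \<Rightarrow> 'y \<Rightarrow> real) \<Rightarrow> (nat \<Rightarrow> 'w set) \<Rightarrow> (nat \<Rightarrow> 'w \<Rightarrow> 'y) \<Rightarrow> bool" where
  "equi_continuous_in dW dY W h \<longleftrightarrow>
    (\<forall>\<epsilon>>0. \<exists>\<delta>>0. \<forall>n. \<forall>x\<in>W n. \<forall>y\<in>W n. dW x y < \<delta> \<longrightarrow> dY (h n x) (h n y) < \<epsilon>)"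

definition equi_semiconjugate ::
    "('z \<Rightarrow> 'z \<Rightarrow> real) \<Rightarrow> (nat \<Rightarrow> 'z set) \<Rightarrow> (nat \<Rightarrow> 'z \<Rightarrow> 'z) \<Rightarrow>
     ('y \<Rightarrow> 'y \<Rightarrow> real) \<Rightarrow> 'y set \<Rightarrow> ('y \<Rightarrow> 'y) \<Rightarrow> bool" where
  "equi_semiconjugate dZ C g dY Y \<sigma> \<longleftrightarrow>
    (\<exists>h. (\<forall>n. h n ` C n = Y) \<and> equi_continuous_in dZ dY C h \<and>
         (\<forall>n. \<forall>z\<in>C n. h (Suc n) (g n z) = \<sigma> (h n z)))"


section \<open>Topological entropy\<close>

definition open_cover :: "'z topology \<Rightarrow> 'z set set \<Rightarrow> bool" where
  "open_cover Z \<A> \<longleftrightarrow> (\<forall>U\<in>\<A>. openin Z U) \<and> \<Union>\<A> = topspace Z"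

definition join_cover :: "'z topology \<Rightarrow> (nat \<Rightarrow> 'z \<Rightarrow> 'z) \<Rightarrow> 'z set set \<Rightarrow> nat \<Rightarrow> 'z set set" where
  "join_cover Z g \<A> n =
    {{z \<in> topspace Z. \<forall>j<n. iter g 0 j z \<in> U j} | U. \<forall>j<n. U j \<in> \<A>}"

definition restrict_cover :: "'z set set \<Rightarrow> 'z set \<Rightarrow> 'z set set" where
  "restrict_cover \<B> Y = (\<lambda>B. B \<inter> Y) ` \<B>"

text \<open>The minimum is taken over finite subcovers, because \<^const>\<open>card\<close> is 0 on infinite sets. In
  a compact space the covers \<open>join_cover Z g \<A> n\<close> of an open cover \<open>\<A>\<close> always have finite
  subcovers.\<close>

definition min_subcover :: "'z set set \<Rightarrow> 'z set \<Rightarrow> nat" where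
  "min_subcover \<B> Y = (LEAST k. \<exists>\<D>. \<D> \<subseteq> \<B> \<and> finite \<D> \<and> Y \<subseteq> \<Union>\<D> \<and> card \<D> = k)"

definition topological_entropy :: "'z topology \<Rightarrow> (nat \<Rightarrow> 'z \<Rightarrow> 'z) \<Rightarrow> 'z set \<Rightarrow> ereal" where
  "topological_entropy Z g Y =
    (SUP \<A> \<in> {\<A>. open_cover Z \<A>}.
       limsup (\<lambda>n. ereal (ln (real (min_subcover (restrict_cover (join_cover Z g \<A> n) Y) Y)) / real n)))"


section \<open>The hyperspace of nonempty compact sets\<close>

definition hyperspace :: "'a::metric_space set set" where
  "hyperspace = {B. compact B \<and> B \<noteq> {}}"

definition subsets_in_hyperspace :: "'a::metric_space set \<Rightarrow> 'a set set" where
  "subsets_in_hyperspace K = {B \<in> hyperspace. B \<subseteq> K}"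

text \<open>Off the hyperspace the distance is set to 0: the locale \<^locale>\<open>Metric_space\<close> requires
  nonnegativity for all arguments, and the suprema are unspecified there.\<close>

definition hausdorff_dist :: "'a::metric_space set \<Rightarrow> 'a set \<Rightarrow> real" where
  "hausdorff_dist B C =
    (if B \<in> hyperspace \<and> C \<in> hyperspace
     then max (SUP b\<in>B. infdist b C) (SUP c\<in>C. infdist c B) else 0)"

definition hyperspace_topology :: "'a::metric_space set topology" where
  "hyperspace_topology = Metric_space.mtopology hyperspace hausdorff_dist"

definition induced_map :: "(nat \<Rightarrow> 'a \<Rightarrow> 'a) \<Rightarrow> nat \<Rightarrow> 'a set \<Rightarrow> 'a set" where
  "induced_map f n B = f n ` B"

lemma bdd_above_infdist:
  assumes "compact B"
  shows "bdd_above ((\<lambda>b. infdist b C) ` B)"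
  by (rule bounded_imp_bdd_above)
     (intro compact_imp_bounded compact_continuous_image continuous_intros assms)

lemma infdist_le_hausdorff_dist:
  assumes "B \<in> hyperspace" "C \<in> hyperspace" "b \<in> B"
  shows "infdist b C \<le> hausdorff_dist B C"
proof -
  have "infdist b C \<le> (SUP b\<in>B. infdist b C)"
    using assms by (intro cSUP_upper bdd_above_infdist) (auto simp: hyperspace_def)
  with assms show ?thesis
    by (simp add: hausdorff_dist_def)
qed

lemma hausdorff_dist_commute: "hausdorff_dist B C = hausdorff_dist C B"
  by (simp add: hausdorff_dist_def max.commute)

lemma hausdorff_dist_nonneg: "0 \<le> hausdorff_dist B C"
proof (cases "B \<in> hyperspace \<and> C \<in> hyperspace")
  case True
  then obtain b where "b \<in> B"
    by (auto simp: hyperspace_def)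
  then show ?thesis
    using infdist_le_hausdorff_dist[of B C b] infdist_nonneg[of b C] True by linarith
qed (auto simp: hausdorff_dist_def)

lemma infdist_triangle_hausdorff:
  assumes "B \<in> hyperspace" "C \<in> hyperspace" "D \<in> hyperspace" "b \<in> B"
  shows "infdist b D \<le> hausdorff_dist B C + hausdorff_dist C D"
proof -
  have "C \<noteq> {}"
    using assms by (simp add: hyperspace_def)
  have "infdist b D - hausdorff_dist C D \<le> dist b c" if "c \<in> C" for c
    using infdist_triangle[of b D c] infdist_le_hausdorff_dist[of C D c] that assms by linarith
  then have "infdist b D - hausdorff_dist C D \<le> infdist b C"
    using \<open>C \<noteq> {}\<close> by (simp add: infdist_notempty cINF_greatest)
  with infdist_le_hausdorff_dist[of B C b] assms show ?thesis by linarith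
qed

lemma hausdorff_dist_triangle:
  assumes "B \<in> hyperspace" "C \<in> hyperspace" "D \<in> hyperspace"
  shows "hausdorff_dist B D \<le> hausdorff_dist B C + hausdorff_dist C D"
proof -
  have "(SUP b\<in>B. infdist b D) \<le> hausdorff_dist B C + hausdorff_dist C D"
    using assms by (intro cSUP_least infdist_triangle_hausdorff) (auto simp: hyperspace_def)
  moreover have "(SUP b\<in>D. infdist b B) \<le> hausdorff_dist D C + hausdorff_dist C B"
    using assms by (intro cSUP_least infdist_triangle_hausdorff) (auto simp: hyperspace_def)
  ultimately show ?thesis
    using assms hausdorff_dist_commute[of D C] hausdorff_dist_commute[of C B]
    by (simp add: hausdorff_dist_def[of B D])
qed

lemma hausdorff_dist_0_imp_subset:
  assumes "B \<in> hyperspace" "C \<in> hyperspace" "hausdorff_dist B C = 0"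
  shows "B \<subseteq> C"
proof
  fix b assume "b \<in> B"
  then have "infdist b C = 0"
    using infdist_le_hausdorff_dist[of B C b] infdist_nonneg[of b C] assms by linarith
  moreover have "closed C" "C \<noteq> {}"
    using assms by (auto simp: hyperspace_def compact_imp_closed)
  ultimately show "b \<in> C"
    by (simp add: in_closed_iff_infdist_zero)
qed

lemma hausdorff_dist_self: "hausdorff_dist B B = 0"
proof (cases "B \<in> hyperspace")
  case True
  then have "(\<lambda>b. infdist b B) ` B = {0}"
    by (force simp: hyperspace_def)
  then show ?thesis
    by (simp add: hausdorff_dist_def)
qed (simp add: hausdorff_dist_def)

lemma Metric_space_hyperspace: "Metric_space hyperspace hausdorff_dist"
proof
  fix B C :: "'a set"
  assume "B \<in> hyperspace" "C \<in> hyperspace"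
  then show "hausdorff_dist B C = 0 \<longleftrightarrow> B = C"
    using hausdorff_dist_0_imp_subset[of B C] hausdorff_dist_0_imp_subset[of C B]
      hausdorff_dist_self[of B] hausdorff_dist_commute[of C B] by auto
qed (rule hausdorff_dist_nonneg hausdorff_dist_commute hausdorff_dist_triangle; assumption)+


section \<open>Transition matrices and symbolic dynamics\<close>

text \<open>The index set \<open>{1,\<dots>,N}\<close> is an arbitrary finite type \<open>'n\<close> with \<open>CARD('n) = N\<close>.\<close>

definition transition_matrix :: "real^'n^'n \<Rightarrow> bool" where
  "transition_matrix A \<longleftrightarrow>
    CARD('n) \<ge> 2 \<and> (\<forall>i j. A $ i $ j \<in> {0, 1}) \<and>
    (\<forall>i. (\<Sum>j\<in>UNIV. A $ i $ j) \<ge> 1) \<and> (\<forall>j. (\<Sum>i\<in>UNIV. A $ i $ j) \<ge> 1)"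

text \<open>The operator \<open>^\<close> on \<^typ>\<open>real^'n^'n\<close> would be the entrywise power.\<close>

definition matrix_power :: "real^'n^'n \<Rightarrow> nat \<Rightarrow> real^'n^'n" where
  "matrix_power A n = (((**) A) ^^ n) (mat 1)"

definition entry_sum :: "real^'n^'n \<Rightarrow> real" where
  "entry_sum B = (\<Sum>i\<in>UNIV. \<Sum>j\<in>UNIV. B $ i $ j)"

definition growth_rate :: "real^'n^'n \<Rightarrow> real" where
  "growth_rate A = lim (\<lambda>n. root n (entry_sum (matrix_power A n)))"

definition subshift :: "real^'n^'n \<Rightarrow> (nat \<Rightarrow> 'n) set" where
  "subshift A = {s. \<forall>j. A $ s j $ s (Suc j) = 1}"

definition shift_map :: "(nat \<Rightarrow> 'n) \<Rightarrow> nat \<Rightarrow> 'n" where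
  "shift_map s = (\<lambda>j. s (Suc j))"

definition symbol_dist :: "(nat \<Rightarrow> 'n) \<Rightarrow> (nat \<Rightarrow> 'n) \<Rightarrow> real" where
  "symbol_dist \<alpha> \<beta> = (\<Sum>i. (if \<alpha> i = \<beta> i then 0 else 1) / 2 ^ i)"

definition weakly_coupled_expanding ::
    "(nat \<Rightarrow> 'a \<Rightarrow> 'a::metric_space) \<Rightarrow> real^'n^'n \<Rightarrow> ('n \<Rightarrow> nat \<Rightarrow> 'a set) \<Rightarrow> bool" where
  "weakly_coupled_expanding f A V \<longleftrightarrow>
    (\<forall>i j n. i \<noteq> j \<longrightarrow> V i n \<inter> V j n = frontier (V i n) \<inter> frontier (V j n)) \<and>
    (\<forall>i n. (\<Union>j\<in>{j. A $ i $ j = 1}. V j (Suc n)) \<subseteq> f n ` V i n)"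

end

theory Submission
  imports Defs
begin

text \<open>Take for \<open>\<C> n\<close> all compact sets \<open>B\<close> whose images under the iterates follow some \<open>s\<close> of the
  subshift through the sets \<open>V (s k) (n + k)\<close>. Such an \<open>s\<close> is unique because the \<open>W i\<close> are disjoint,
  and \<open>B \<mapsto> s\<close> is the semiconjugacy; disjoint compact sets have positive distance, which gives
  equi-continuity. Every column of \<open>A\<close> has a nonzero entry, so every \<open>B\<close> at time \<open>n + 1\<close> is the image
  of \<open>V i n \<inter> f n -` B\<close> for a suitable \<open>i\<close>. The hyperspace of a compact space is compact, so it
  suffices that \<open>\<C> n\<close> is closed. For the entropy, cover the hyperspace by the complements of
  \<open>\<Union>j \<noteq> i. \<langle>W j\<rangle>\<close>: a subcover of the \<open>n\<close>-th join needs a separate element for each of the words of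
  length \<open>n\<close> of the subshift, whose number is the entry sum of \<open>A\<close> to the power \<open>n - 1\<close>.\<close>

section \<open>Compactness of the hyperspace\<close>

lemma hausdorff_dist_le:
  assumes "B \<in> hyperspace" "C \<in> hyperspace"
    and "\<And>b. b \<in> B \<Longrightarrow> \<exists>c\<in>C. dist b c \<le> e" "\<And>c. c \<in> C \<Longrightarrow> \<exists>b\<in>B. dist b c \<le> e"
  shows "hausdorff_dist B C \<le> e"
proof -
  have "infdist b C \<le> e" if "b \<in> B" for b
    using assms(3)[OF that] infdist_le2 by blast
  moreover have "infdist c B \<le> e" if "c \<in> C" for c
    using assms(4)[OF that] infdist_le2 by (metis dist_commute)
  ultimately show ?thesis
    using assms(1,2) by (auto simp: hausdorff_dist_def hyperspace_def intro!: cSUP_least)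
qed

lemma hausdorff_dist_less_nearby_point:
  assumes "B \<in> hyperspace" "C \<in> hyperspace" "hausdorff_dist B C < e" "b \<in> B"
  obtains c where "c \<in> C" "dist b c < e"
proof -
  have "infdist b C < e" "C \<noteq> {}"
    using infdist_le_hausdorff_dist[OF assms(1,2,4)] assms(2,3) by (auto simp: hyperspace_def)
  then have "\<exists>c\<in>C. dist b c < e"
    by (simp add: infdist_notempty cINF_less_iff)
  then show ?thesis
    using that by blast
qed

lemma hyperspace_UNIV_iff:
  assumes "compact (UNIV :: 'a::metric_space set)"
  shows "(B :: 'a set) \<in> hyperspace \<longleftrightarrow> closed B \<and> B \<noteq> {}"
  using assms compact_Int_closed[of UNIV B] by (auto simp: hyperspace_def compact_imp_closed)

interpretation hyper: Metric_space hyperspace hausdorff_dist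
  by (rule Metric_space_hyperspace)

lemma topspace_hyperspace [simp]: "topspace hyperspace_topology = hyperspace"
  by (simp add: hyperspace_topology_def)

text \<open>The nonempty subsets of a finite \<open>e/2\<close>-net \<open>F\<close> of the space
  form a finite net of the hyperspace: a compact set is approximated by those points of
  \<open>F\<close> whose balls meet it.\<close>

lemma mtotally_bounded_hyperspace:
  assumes "compact (UNIV :: 'a::metric_space set)"
  shows "Metric_space.mtotally_bounded (hyperspace :: 'a set set) hausdorff_dist hyperspace"
  unfolding hyper.mtotally_bounded_def
proof (intro allI impI)
  fix e :: real assume "e > 0"
  then obtain F :: "'a set" where F: "finite F" "UNIV \<subseteq> (\<Union>x\<in>F. ball x (e/2))"
    using assms half_gt_zero unfolding compact_eq_totally_bounded by blast
  let ?K = "Pow F - {{}}"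
  have "B \<in> (\<Union>C\<in>?K. Metric_space.mball hyperspace hausdorff_dist C e)"
    if B: "B \<in> hyperspace" for B
  proof -
    define C where "C = {x\<in>F. ball x (e/2) \<inter> B \<noteq> {}}"
    have *: "\<exists>c\<in>C. dist b c \<le> e/2" if "b \<in> B" for b
      using F(2) that by (force simp: C_def dist_commute)
    obtain b where "b \<in> B"
      using B by (auto simp: hyperspace_def)
    with * have "C \<noteq> {}"
      by blast
    moreover have "finite C" "C \<subseteq> F"
      using F(1) by (auto simp: C_def)
    ultimately have C: "C \<in> hyperspace" "C \<in> ?K"
      by (auto simp: hyperspace_def finite_imp_compact)
    have "hausdorff_dist B C \<le> e/2"
      by (rule hausdorff_dist_le[OF B C(1) *]) (force simp: C_def dist_commute)+
    then have "hausdorff_dist C B < e"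
      using \<open>e > 0\<close> by (simp add: hausdorff_dist_commute)
    then show ?thesis
      using B C by (auto simp: hyper.in_mball)
  qed
  moreover have "finite ?K" "?K \<subseteq> hyperspace"
    using F(1) finite_subset by (auto simp: hyperspace_def intro!: finite_imp_compact)
  ultimately show "\<exists>K. finite K \<and> K \<subseteq> hyperspace \<and>
      (hyperspace :: 'a set set) \<subseteq> (\<Union>x\<in>K. Metric_space.mball hyperspace hausdorff_dist x e)"
    by blast
qed

text \<open>The limit of a Cauchy sequence \<open>S\<close> is its upper limit \<open>L\<close>, the
  set of cluster points of sequences that select a point from each \<open>S m\<close>. Compactness
  of the space supplies enough such points.\<close>

lemma mcomplete_hyperspace:
  assumes "compact (UNIV :: 'a::metric_space set)"
  shows "Metric_space.mcomplete (hyperspace :: 'a set set) hausdorff_dist"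
  unfolding hyper.mcomplete_def
proof (intro allI impI)
  fix S :: "nat \<Rightarrow> 'a set" assume S: "Metric_space.MCauchy hyperspace hausdorff_dist S"
  then have hyp: "S n \<in> hyperspace" for n
    by (auto simp: hyper.MCauchy_def)
  define L where "L = (\<Inter>n. closure (\<Union>m\<in>{n..}. S m))"
  \<comment> \<open>A convergent subsequence of the points close to \<open>b\<close> has its limit
    in the closure of every tail union, and the weak inequality survives the limit.\<close>
  have limit_point: "\<exists>c\<in>L. dist b c \<le> e"
    if near: "\<And>m. m \<ge> n \<Longrightarrow> \<exists>y\<in>S m. dist b y \<le> e" for b e n
  proof -
    obtain y where y: "y m \<in> S m" "dist b (y m) \<le> e" if "m \<ge> n" for m
      using near by metis
    obtain c r where r: "strict_mono r" and lim: "(y \<circ> r) \<longlonglongrightarrow> c"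
      using assms unfolding compact_def by blast
    have ev: "\<forall>\<^sub>F k in sequentially. m \<le> r k" for m
      using r by (meson eventually_sequentiallyI order_trans seq_suble)
    have "c \<in> closure (\<Union>m\<in>{k..}. S m)" for k
    proof (rule Lim_in_closed_set[OF closed_closure _ sequentially_bot lim])
      show "\<forall>\<^sub>F j in sequentially. (y \<circ> r) j \<in> closure (\<Union>m\<in>{k..}. S m)"
        using ev[of "max k n"]
        by eventually_elim (use y(1) in \<open>auto intro!: subsetD[OF closure_subset]\<close>)
    qed
    moreover have "dist b c \<le> e"
    proof (rule tendsto_upperbound[OF tendsto_dist[OF tendsto_const lim]])
      show "\<forall>\<^sub>F j in sequentially. dist b ((y \<circ> r) j) \<le> e"
        using ev[of n] by eventually_elim (use y(2) in auto)
    qed simp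
    ultimately show ?thesis
      by (auto simp: L_def)
  qed
  have Cauchy: "\<exists>N. \<forall>n n'. N \<le> n \<longrightarrow> N \<le> n' \<longrightarrow> hausdorff_dist (S n) (S n') < e" if "e > 0" for e
    using S that by (auto simp: hyper.MCauchy_def)
  have to_L: "\<exists>c\<in>L. dist b c \<le> e"
    if N: "\<forall>n n'. N \<le> n \<longrightarrow> N \<le> n' \<longrightarrow> hausdorff_dist (S n) (S n') < e" "n \<ge> N" "b \<in> S n" for b e n N
    by (rule limit_point[of n])
       (metis N hausdorff_dist_less_nearby_point hyp le_trans less_imp_le)
  have "L \<noteq> {}"
  proof -
    obtain N where N: "\<forall>n n'. N \<le> n \<longrightarrow> N \<le> n' \<longrightarrow> hausdorff_dist (S n) (S n') < 1"
      using Cauchy[of 1] by auto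
    obtain b where "b \<in> S N"
      using hyp[of N] by (auto simp: hyperspace_def)
    then show ?thesis
      using to_L[OF N] by blast
  qed
  then have L: "L \<in> hyperspace"
    by (auto simp: hyperspace_UNIV_iff[OF assms] L_def)
  have "\<exists>N. \<forall>n\<ge>N. S n \<in> hyperspace \<and> hausdorff_dist (S n) L < e" if "e > 0" for e
  proof -
    obtain N where N: "\<forall>n n'. N \<le> n \<longrightarrow> N \<le> n' \<longrightarrow> hausdorff_dist (S n) (S n') < e/3"
      using Cauchy[OF divide_pos_pos[OF \<open>e > 0\<close> zero_less_numeral]] by blast
    \<comment> \<open>\<open>hausdorff_dist_le\<close> yields only a weak bound, hence the slack
      below \<open>e\<close>. From a point of \<open>L\<close>, one third is spent on reaching some
      later \<open>S m\<close>, another on passing from \<open>S m\<close> to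
      \<open>S n\<close>.\<close>
    have "hausdorff_dist (S n) L \<le> 2 * (e/3)" if n: "n \<ge> N" for n
    proof (rule hausdorff_dist_le[OF hyp L])
      fix b assume "b \<in> S n"
      then obtain c where "c \<in> L" "dist b c \<le> e/3"
        using to_L[OF N n] by blast
      with \<open>e > 0\<close> show "\<exists>c\<in>L. dist b c \<le> 2 * (e/3)"
        by (intro bexI[of _ c]) auto
    next
      fix c assume "c \<in> L"
      then have "c \<in> closure (\<Union>m\<in>{n..}. S m)"
        by (auto simp: L_def)
      then obtain y m where y: "m \<ge> n" "y \<in> S m" "dist y c < e/3"
        using \<open>e > 0\<close> unfolding closure_approachable
        by (metis UN_iff atLeast_iff divide_pos_pos zero_less_numeral)
      then have "hausdorff_dist (S m) (S n) < e/3"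
        using N n by auto
      then obtain b where "b \<in> S n" "dist y b < e/3"
        using hausdorff_dist_less_nearby_point[OF hyp hyp _ y(2)] by blast
      then show "\<exists>b\<in>S n. dist b c \<le> 2 * (e/3)"
        using y(3) dist_triangle3[of b c y] by (intro bexI[of _ b]) auto
    qed
    then show ?thesis
      using \<open>e > 0\<close> hyp by (intro exI[of _ N]) force
  qed
  then show "\<exists>L. limitin (Metric_space.mtopology hyperspace hausdorff_dist) S L sequentially"
    using L by (auto simp: hyper.limit_metric_sequentially)
qed

lemma compact_space_hyperspace:
  assumes "compact (UNIV :: 'a::metric_space set)"
  shows "compact_space (hyperspace_topology :: 'a set topology)"
  using mcomplete_hyperspace[OF assms] mtotally_bounded_hyperspace[OF assms]
  by (simp add: hyperspace_topology_def hyper.compact_space_eq_mcomplete_mtotally_bounded)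

text \<open>A compact set not inside \<open>K\<close> has a point with a ball in the open
  complement, and every set at Hausdorff distance below the radius of that ball has a point in
  it.\<close>

lemma closedin_subsets_in_hyperspace:
  assumes "closed K"
  shows "closedin hyperspace_topology (subsets_in_hyperspace K)"
  unfolding hyperspace_topology_def hyper.closedin_metric
proof (intro conjI allI impI)
  show "subsets_in_hyperspace K \<subseteq> hyperspace"
    by (auto simp: subsets_in_hyperspace_def)
  fix B assume "B \<in> hyperspace - subsets_in_hyperspace K"
  then obtain b where B: "B \<in> hyperspace" and b: "b \<in> B" "b \<in> - K"
    by (auto simp: subsets_in_hyperspace_def)
  then obtain r where r: "r > 0" "ball b r \<subseteq> - K"
    using assms open_contains_ball open_Compl by metis
  have "\<not> C \<subseteq> K" if C: "C \<in> hyperspace" "hausdorff_dist B C < r" for C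
  proof -
    obtain c where "c \<in> C" "dist b c < r"
      using hausdorff_dist_less_nearby_point[OF B C b(1)] .
    with r show ?thesis
      by auto
  qed
  then show "\<exists>r>0. disjnt (subsets_in_hyperspace K) (Metric_space.mball hyperspace hausdorff_dist B r)"
    using r(1) by (auto simp: disjnt_iff subsets_in_hyperspace_def hyper.in_mball)
qed


section \<open>Growth of subadditive sequences\<close>

text \<open>Fekete's subadditive lemma: the limit is the infimum of the quotients, finite by
  nonnegativity. Division with remainder by a nearly optimal \<open>m\<close> controls all later
  terms.\<close>

lemma Fekete_nonneg:
  fixes a :: "nat \<Rightarrow> real"
  assumes sub: "\<And>m n. a (m + n) \<le> a m + a n" and nonneg: "\<And>n. 0 \<le> a n"
  shows "convergent (\<lambda>n. a n / real n)"
proof -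
  \<comment> \<open>The infimum starts at 1: division by zero gives 0, so the term at
    \<open>n = 0\<close> would pull it down to 0.\<close>
  define L where "L = (INF n\<in>{1..}. a n / real n)"
  have bdd: "bdd_below ((\<lambda>n. a n / real n) ` {1..})"
    using nonneg by (intro bdd_belowI[of _ 0]) auto
  have lower: "L \<le> a n / real n" if "n \<ge> 1" for n
    unfolding L_def using that by (intro cINF_lower bdd) auto
  have mult: "a (q * m + r) \<le> real q * a m + a r" for q m r
  proof (induction q)
    case (Suc q)
    then show ?case
      using sub[of m "q * m + r"] by (simp add: algebra_simps)
  qed simp
  have "(\<lambda>n. a n / real n) \<longlonglongrightarrow> L"
  proof (rule LIMSEQ_I)
    fix e :: real assume "e > 0"
    then obtain m where m: "m \<ge> 1" "a m / real m < L + e/2"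
      using cINF_less_iff[OF _ bdd, of "L + e/2"] unfolding L_def by (auto simp: L_def)
    \<comment> \<open>The remainders \<open>n mod m\<close> contribute at most the constant
      \<open>M\<close>, and \<open>M / n\<close> tends to 0.\<close>
    define M where "M = Max (a ` {..<m})"
    have M: "a r \<le> M" if "r < m" for r
      using that by (auto simp: M_def)
    have "M \<ge> 0"
      using M[of 0] nonneg[of 0] m(1) by linarith
    have bound: "a n / real n \<le> a m / real m + M / real n" if "n \<ge> 1" for n
    proof -
      have "a n \<le> real (n div m) * a m + a (n mod m)"
        using mult[of "n div m" m "n mod m"] by simp
      also have "\<dots> \<le> (real n / real m) * a m + M"
        using M[of "n mod m"] m(1) of_nat_div_le_of_nat[of n m]
        by (intro add_mono mult_right_mono nonneg) auto
      finally show ?thesis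
        using that m(1) by (simp add: field_simps)
    qed
    obtain n0 :: nat where n0: "real n0 > 2 * M / e"
      using reals_Archimedean2 by blast
    have "norm (a n / real n - L) < e" if n: "n \<ge> Suc n0" for n
    proof -
      have "2 * M / e < real n"
        using n0 n by simp
      then have "M / real n < e / 2"
        using \<open>e > 0\<close> n by (simp add: field_simps)
      moreover have "L \<le> a n / real n" "a n / real n \<le> a m / real m + M / real n"
        using bound[of n] lower[of n] n by auto
      ultimately show ?thesis
        using m(2) unfolding real_norm_def by linarith
    qed
    then show "\<exists>n0. \<forall>n\<ge>n0. norm (a n / real n - L) < e"
      by blast
  qed
  then show ?thesis
    by (rule convergentI)
qed


section \<open>Words of the subshift\<close>

definition prefix :: "nat \<Rightarrow> (nat \<Rightarrow> 'b) \<Rightarrow> 'b list" where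
  "prefix n s = map s [0..<n]"

lemma length_prefix [simp]: "length (prefix n s) = n"
  by (simp add: prefix_def)

lemma nth_prefix [simp]: "k < n \<Longrightarrow> prefix n s ! k = s k"
  by (simp add: prefix_def)

lemma prefix_eq_iff: "prefix n s = prefix n t \<longleftrightarrow> (\<forall>k<n. s k = t k)"
  by (auto simp: list_eq_iff_nth_eq)

lemma prefix_Suc: "prefix (Suc n) s = s 0 # prefix n (shift_map s)"
  by (auto simp: list_eq_iff_nth_eq nth_Cons shift_map_def split: nat.split)

text \<open>Only prefixes of infinite sequences are counted; since every row of a transition matrix
  has an entry 1, these are all finite admissible paths.\<close>

definition words :: "real^'n^'n \<Rightarrow> nat \<Rightarrow> 'n list set" where
  "words A n = prefix n ` subshift A"

lemma finite_words: "finite (words (A :: real^'n^'n) n)"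
proof (rule finite_subset)
  show "words A n \<subseteq> {xs. set xs \<subseteq> UNIV \<and> length xs = n}"
    by (auto simp: words_def)
qed (rule finite_lists_length_eq, simp)

lemma shift_map_in_subshift: "s \<in> subshift A \<Longrightarrow> shift_map s \<in> subshift A"
  by (simp add: subshift_def shift_map_def)

lemma case_nat_in_subshift:
  "s \<in> subshift A \<Longrightarrow> A $ i $ s 0 = 1 \<Longrightarrow> case_nat i s \<in> subshift A"
  by (auto simp: subshift_def split: nat.split)

lemma transition_matrix_entry:
  "transition_matrix A \<Longrightarrow> A $ i $ j = (if A $ i $ j = 1 then 1 else 0)"
  by (auto simp: transition_matrix_def)

lemma transition_matrix_successor:
  assumes "transition_matrix A"
  obtains j where "A $ i $ j = 1"
proof -
  have "(\<Sum>j\<in>UNIV. A $ i $ j) \<noteq> 0"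
    using assms by (auto simp: transition_matrix_def dest: spec[of _ i])
  then obtain j where "A $ i $ j \<noteq> 0"
    by (meson sum.neutral)
  then show ?thesis
    using that transition_matrix_entry[OF assms] by metis
qed

lemma transition_matrix_predecessor:
  assumes "transition_matrix A"
  obtains i where "A $ i $ j = 1"
proof -
  have "(\<Sum>i\<in>UNIV. A $ i $ j) \<noteq> 0"
    using assms by (auto simp: transition_matrix_def dest: spec[of _ j])
  then obtain i where "A $ i $ j \<noteq> 0"
    by (meson sum.neutral)
  then show ?thesis
    using that transition_matrix_entry[OF assms] by metis
qed

text \<open>Every row has an entry 1, so a successor function can be chosen and iterated.\<close>

lemma subshift_starting_at:
  assumes "transition_matrix A"
  obtains s where "s \<in> subshift A" "s 0 = i"
proof -
  have "\<forall>i. \<exists>j. A $ i $ j = 1"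
    using transition_matrix_successor[OF assms] by blast
  then obtain succ where succ: "A $ i $ succ i = 1" for i
    by metis
  have "(\<lambda>k. (succ ^^ k) i) \<in> subshift A"
    using succ by (simp add: subshift_def)
  then show ?thesis
    using that by force
qed

text \<open>The \<open>n\<close>-th matrix power counts paths with \<open>n\<close> edges, which are
  words of length \<open>Suc n\<close>. The induction splits off the first letter, in accordance
  with the left multiplication in \<open>matrix_power\<close>.\<close>

lemma row_sum_matrix_power:
  assumes "transition_matrix A"
  shows "(\<Sum>j\<in>UNIV. matrix_power A n $ i $ j) =
    real (card (prefix (Suc n) ` {s \<in> subshift A. s 0 = i}))"
proof (induction n arbitrary: i)
  case 0
  obtain s where "s \<in> subshift A" "s 0 = i"
    using subshift_starting_at[OF assms] .
  then have "prefix (Suc 0) ` {s \<in> subshift A. s 0 = i} = {[i]}"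
    by (auto simp: prefix_def)
  then show ?case
    by (simp add: matrix_power_def mat_def)
next
  case (Suc n)
  let ?P = "\<lambda>n i. prefix n ` {s \<in> subshift A. s 0 = i}"
  have split: "?P (Suc (Suc n)) i = (\<Union>k\<in>{k. A $ i $ k = 1}. (#) i ` ?P (Suc n) k)"
  proof (intro equalityI subsetI)
    fix w assume "w \<in> ?P (Suc (Suc n)) i"
    then obtain s where s: "s \<in> subshift A" "s 0 = i" "w = prefix (Suc (Suc n)) s"
      by auto
    moreover have "A $ i $ (shift_map s 0) = 1"
      using s by (auto simp: subshift_def shift_map_def)
    ultimately show "w \<in> (\<Union>k\<in>{k. A $ i $ k = 1}. (#) i ` ?P (Suc n) k)"
      using shift_map_in_subshift[OF s(1)] prefix_Suc[of "Suc n" s] by blast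
  next
    fix w assume "w \<in> (\<Union>k\<in>{k. A $ i $ k = 1}. (#) i ` ?P (Suc n) k)"
    then obtain s where s: "s \<in> subshift A" "A $ i $ s 0 = 1" "w = i # prefix (Suc n) s"
      by auto
    then have "w = prefix (Suc (Suc n)) (case_nat i s)"
      by (simp add: prefix_Suc[of "Suc n"] shift_map_def)
    with case_nat_in_subshift[OF s(1,2)] show "w \<in> ?P (Suc (Suc n)) i"
      by force
  qed
  have fin: "finite (?P (Suc n) k)" for k
    using finite_words[of A "Suc n"] by (rule finite_subset[rotated]) (auto simp: words_def)
  \<comment> \<open>The union is disjoint because its parts differ in the second letter
    \<open>k\<close>.\<close>
  have "card (?P (Suc (Suc n)) i) = (\<Sum>k\<in>{k. A $ i $ k = 1}. card ((#) i ` ?P (Suc n) k))"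
    unfolding split
    by (intro card_UN_disjoint ballI finite_imageI fin) (auto simp: prefix_Suc)
  also have "\<dots> = (\<Sum>k\<in>{k. A $ i $ k = 1}. card (?P (Suc n) k))"
    by (intro sum.cong refl card_image) auto
  finally have "real (card (?P (Suc (Suc n)) i)) =
      (\<Sum>k\<in>{k. A $ i $ k = 1}. \<Sum>j\<in>UNIV. matrix_power A n $ k $ j)"
    by (simp add: Suc)
  also have "\<dots> = (\<Sum>k\<in>UNIV. A $ i $ k * (\<Sum>j\<in>UNIV. matrix_power A n $ k $ j))"
    by (subst transition_matrix_entry[OF assms]) (simp add: if_distrib[of "\<lambda>x. x * _"] sum.If_cases)
  also have "\<dots> = (\<Sum>j\<in>UNIV. \<Sum>k\<in>UNIV. A $ i $ k * matrix_power A n $ k $ j)"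
    unfolding sum_distrib_left by (rule sum.swap)
  also have "\<dots> = (\<Sum>j\<in>UNIV. matrix_power A (Suc n) $ i $ j)"
    by (simp add: matrix_power_def matrix_matrix_mult_def)
  finally show ?case ..
qed

lemma entry_sum_matrix_power:
  assumes "transition_matrix A"
  shows "entry_sum (matrix_power A n) = real (card (words A (Suc n)))"
proof -
  let ?P = "\<lambda>i. prefix (Suc n) ` {s \<in> subshift A. s 0 = i}"
  have "words A (Suc n) = (\<Union>i\<in>UNIV. ?P i)"
    by (auto simp: words_def)
  moreover have "finite (?P i)" for i
    using finite_words[of A "Suc n"] by (rule finite_subset[rotated]) (auto simp: words_def)
  ultimately have "card (words A (Suc n)) = (\<Sum>i\<in>UNIV. card (?P i))"
    by (simp only:) (intro card_UN_disjoint; auto simp: prefix_Suc)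
  then show ?thesis
    by (simp add: entry_sum_def row_sum_matrix_power[OF assms])
qed

text \<open>A word with \<open>m + n\<close> edges is glued from words with \<open>m\<close> and
  \<open>n\<close> edges that share the letter at position \<open>m\<close>; \<open>tl\<close>
  removes its second copy.\<close>

lemma card_words_add_le:
  "card (words A (Suc (m + n))) \<le> card (words A (Suc m)) * card (words (A :: real^'n^'n) (Suc n))"
proof -
  have "words A (Suc (m + n)) \<subseteq> (\<lambda>(u, v). u @ tl v) ` (words A (Suc m) \<times> words A (Suc n))"
  proof
    fix w assume "w \<in> words A (Suc (m + n))"
    then obtain s where s: "s \<in> subshift A" "w = prefix (Suc (m + n)) s"
      by (auto simp: words_def)
    have "(\<lambda>k. s (m + k)) \<in> subshift A"
      using s(1) by (simp add: subshift_def)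
    moreover have "w = prefix (Suc m) s @ tl (prefix (Suc n) (\<lambda>k. s (m + k)))"
      by (auto simp: s(2) list_eq_iff_nth_eq nth_append nth_tl)
    ultimately show "w \<in> (\<lambda>(u, v). u @ tl v) ` (words A (Suc m) \<times> words A (Suc n))"
      using s(1) by (force simp: words_def)
  qed
  then have "card (words A (Suc (m + n))) \<le> card (words A (Suc m) \<times> words A (Suc n))"
    by (intro surj_card_le) (auto simp: finite_words)
  then show ?thesis
    by (simp add: card_cartesian_product)
qed

lemma card_words_pos:
  assumes "transition_matrix A"
  shows "card (words A n) \<ge> 1"
proof -
  have "words A n \<noteq> {}"
    using subshift_starting_at[OF assms] by (auto simp: words_def)
  then show ?thesis
    by (simp add: Suc_leI card_gt_0_iff finite_words)
qed

text \<open>Fekete's lemma for the logarithms of the word counts shows that the limit defining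
  \<open>growth_rate\<close> exists, so that \<open>lim\<close> denotes it.\<close>

lemma words_growth_rate:
  assumes "transition_matrix A"
  shows "(\<lambda>n. ln (real (card (words A n))) / real n) \<longlonglongrightarrow> ln (growth_rate A)"
proof -
  define a where "a n = ln (real (card (words A (Suc n))))" for n
  have pos: "real (card (words A n)) \<ge> 1" for n
    using card_words_pos[OF assms, of n] by linarith
  have "a (m + n) \<le> a m + a n" for m n
  proof -
    have "real (card (words A (Suc (m + n)))) \<le> real (card (words A (Suc m))) * real (card (words A (Suc n)))"
      using card_words_add_le[of A m n] by (metis of_nat_le_iff of_nat_mult)
    then have "a (m + n) \<le> ln (real (card (words A (Suc m))) * real (card (words A (Suc n))))"
      unfolding a_def using pos by (smt (verit, best) ln_le_cancel_iff)
    also have "\<dots> = a m + a n"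
      unfolding a_def using pos by (smt (verit, best) ln_mult)
    finally show ?thesis .
  qed
  moreover have "a n \<ge> 0" for n
    using pos by (simp add: a_def)
  ultimately obtain L where L: "(\<lambda>n. a n / real n) \<longlonglongrightarrow> L"
    using Fekete_nonneg[of a] by (auto simp: convergent_def)
  have "(\<lambda>n. root n (entry_sum (matrix_power A n))) \<longlonglongrightarrow> exp L"
  proof (rule Lim_transform_eventually[OF tendsto_exp[OF L]])
    show "\<forall>\<^sub>F n in sequentially. exp (a n / real n) = root n (entry_sum (matrix_power A n))"
      using eventually_gt_at_top[of 0]
    proof eventually_elim
      case (elim n)
      have "entry_sum (matrix_power A n) > 0"
        using pos[of "Suc n"] by (simp add: entry_sum_matrix_power[OF assms])
      then have "root n (entry_sum (matrix_power A n)) = exp (ln (entry_sum (matrix_power A n)) / n)"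
        using elim by (simp add: root_powr_inverse powr_def)
      then show ?case
        by (simp add: a_def entry_sum_matrix_power[OF assms])
    qed
  qed
  then have growth: "ln (growth_rate A) = L"
    by (simp add: growth_rate_def limI)
  \<comment> \<open>The entry sum of the \<open>n\<close>-th power counts words of length
    \<open>Suc n\<close>, so the divisor must change from \<open>n\<close> to \<open>Suc n\<close>;
    the ratio of the two tends to 1.\<close>
  have "(\<lambda>n. a n / real n * (real n / real (Suc n))) \<longlonglongrightarrow> L * 1"
    by (intro tendsto_mult L LIMSEQ_n_over_Suc_n)
  then have "(\<lambda>n. a n / real (Suc n)) \<longlonglongrightarrow> L"
  proof (rule Lim_transform_eventually[OF tendsto_eq_rhs])
    show "\<forall>\<^sub>F n in sequentially. a n / real n * (real n / real (Suc n)) = a n / real (Suc n)"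
      using eventually_gt_at_top[of 0] by eventually_elim auto
  qed simp
  then show ?thesis
    unfolding growth a_def by (rule LIMSEQ_imp_Suc)
qed


section \<open>Entropy from below\<close>

text \<open>The finite cover itself witnesses that the minimum is taken over a nonempty set, so it
  is attained by an actual subcover.\<close>

lemma min_subcover_ge:
  assumes "finite \<B>" "Y \<subseteq> \<Union>\<B>"
    and "\<And>\<D>. \<D> \<subseteq> \<B> \<Longrightarrow> finite \<D> \<Longrightarrow> Y \<subseteq> \<Union>\<D> \<Longrightarrow> k \<le> card \<D>"
  shows "k \<le> min_subcover \<B> Y"
proof -
  have "\<exists>\<D>. \<D> \<subseteq> \<B> \<and> finite \<D> \<and> Y \<subseteq> \<Union>\<D> \<and> card \<D> = min_subcover \<B> Y"
    unfolding min_subcover_def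
    by (rule LeastI_ex) (intro exI[of _ "card \<B>"] exI[of _ \<B>] conjI subset_refl refl assms(1,2))
  then show ?thesis
    using assms(3) by metis
qed

text \<open>Only the first \<open>n\<close> values of \<open>U\<close> matter, so the join is
  indexed by lists of length \<open>n\<close> over a finite set.\<close>

lemma finite_join_cover:
  assumes "finite \<A>"
  shows "finite (join_cover Z g \<A> n)"
proof (rule finite_subset)
  let ?J = "\<lambda>us. {z \<in> topspace Z. \<forall>j<n. iter g 0 j z \<in> us ! j}"
  show "join_cover Z g \<A> n \<subseteq> ?J ` {us. set us \<subseteq> \<A> \<and> length us = n}"
  proof
    fix J assume "J \<in> join_cover Z g \<A> n"
    then obtain U where U: "\<forall>j<n. U j \<in> \<A>" "J = {z \<in> topspace Z. \<forall>j<n. iter g 0 j z \<in> U j}"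
      by (auto simp: join_cover_def)
    then have "J = ?J (prefix n U)"
      by auto
    moreover have "set (prefix n U) \<subseteq> \<A>"
      using U(1) by (auto simp: prefix_def)
    ultimately show "J \<in> ?J ` {us. set us \<subseteq> \<A> \<and> length us = n}"
      by (intro image_eqI[of _ _ "prefix n U"]) auto
  qed
  show "finite (?J ` {us. set us \<subseteq> \<A> \<and> length us = n})"
    by (rule finite_imageI[OF finite_lists_length_eq[OF assms]])
qed

lemma iter_in_topspace:
  assumes "\<And>j. g j ` topspace Z \<subseteq> topspace Z" "z \<in> topspace Z"
  shows "iter g i n z \<in> topspace Z"
  by (induction n) (use assms in auto)

lemma join_cover_covers:
  assumes "open_cover Z \<A>" "\<And>j. g j ` topspace Z \<subseteq> topspace Z"
  shows "topspace Z \<subseteq> \<Union>(join_cover Z g \<A> n)"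
proof
  fix z assume z: "z \<in> topspace Z"
  have "\<exists>U\<in>\<A>. iter g 0 j z \<in> U" for j
    using iter_in_topspace[OF assms(2) z] assms(1) by (auto simp: open_cover_def)
  then obtain U where U: "U j \<in> \<A>" "iter g 0 j z \<in> U j" for j
    by metis
  let ?J = "{z \<in> topspace Z. \<forall>j<n. iter g 0 j z \<in> U j}"
  have "?J \<in> join_cover Z g \<A> n" "z \<in> ?J"
    using U z by (auto simp: join_cover_def)
  then show "z \<in> \<Union>(join_cover Z g \<A> n)"
    by blast
qed

text \<open>Entropy is a supremum over covers, so a single cover bounds it from below. The condition
  \<open>1 \<le> N n\<close> keeps the arguments of \<open>ln\<close> positive, where it is
  monotone.\<close>

lemma topological_entropy_ge:
  fixes N :: "nat \<Rightarrow> nat"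
  assumes "open_cover Z \<A>" "\<And>n. 1 \<le> N n"
    and "\<And>n. N n \<le> min_subcover (restrict_cover (join_cover Z g \<A> n) Y) Y"
    and "(\<lambda>n. ln (real (N n)) / real n) \<longlonglongrightarrow> L"
  shows "ereal L \<le> topological_entropy Z g Y"
proof -
  let ?M = "\<lambda>n. min_subcover (restrict_cover (join_cover Z g \<A> n) Y) Y"
  have "ereal L = limsup (\<lambda>n. ereal (ln (real (N n)) / real n))"
    using assms(4) by (intro lim_imp_Limsup[symmetric]) auto
  also have "\<dots> \<le> limsup (\<lambda>n. ereal (ln (real (?M n)) / real n))"
  proof (intro Limsup_mono always_eventually allI)
    fix n
    have "0 < real (N n)" "real (N n) \<le> real (?M n)"
      using assms(2)[of n] assms(3)[of n] by simp_all
    then have "ln (real (N n)) \<le> ln (real (?M n))"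
      by (smt (verit) ln_le_cancel_iff)
    then show "ereal (ln (real (N n)) / real n) \<le> ereal (ln (real (?M n)) / real n)"
      by (simp add: divide_right_mono)
  qed
  also have "\<dots> \<le> topological_entropy Z g Y"
    unfolding topological_entropy_def using assms(1) by (intro SUP_upper) simp
  finally show ?thesis .
qed


section \<open>Iterates and distances\<close>

lemma iter_Suc_left: "iter g i (Suc n) z = iter g (Suc i) n (g i z)"
  by (induction n) auto

lemma iter_induced_map: "iter (induced_map f) i n B = iter f i n ` B"
  by (induction n) (auto simp: induced_map_def)

lemma continuous_on_iter:
  assumes "\<And>n. continuous_on UNIV (f n)"
  shows "continuous_on UNIV (iter f i n)"
proof (induction n)
  case (Suc n)
  then show ?case
    unfolding iter.simps by (rule continuous_on_compose) (rule continuous_on_subset[OF assms subset_UNIV])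
qed (simp add: id_def)

lemma induced_map_hyperspace:
  assumes "continuous_on UNIV (f n)" "B \<in> hyperspace"
  shows "induced_map f n B \<in> hyperspace"
  using assms by (auto simp: induced_map_def hyperspace_def
      intro: compact_continuous_image continuous_on_subset)

text \<open>The number of steps \<open>k\<close> is fixed; the modulus is uniform in the starting
  time \<open>n\<close> only.\<close>

lemma equi_continuous_in_iter:
  assumes "equi_continuous_in dist dist (\<lambda>n. UNIV) f"
  shows "equi_continuous_in dist dist (\<lambda>n. UNIV) (\<lambda>n. iter f n k)"
proof (induction k)
  case 0
  show ?case
    by (auto simp: equi_continuous_in_def)
next
  case (Suc k)
  show ?case
    unfolding equi_continuous_in_def
  proof (intro allI impI)
    fix e :: real assume "e > 0"
    then obtain d where d: "d > 0" "\<And>n x y. dist x y < d \<Longrightarrow> dist (f n x) (f n y) < e"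
      using assms unfolding equi_continuous_in_def by (metis UNIV_I)
    obtain r where "r > 0" "\<And>n x y. dist x y < r \<Longrightarrow> dist (iter f n k x) (iter f n k y) < d"
      using Suc d(1) unfolding equi_continuous_in_def by (metis UNIV_I)
    with d show "\<exists>\<delta>>0. \<forall>n. \<forall>x\<in>UNIV. \<forall>y\<in>UNIV. dist x y < \<delta> \<longrightarrow>
        dist (iter f n (Suc k) x) (iter f n (Suc k) y) < e"
      by auto
  qed
qed

text \<open>The first \<open>m\<close> terms vanish and a geometric series bounds the tail.\<close>

lemma symbol_dist_le:
  assumes "\<And>k. k < m \<Longrightarrow> s k = t k"
  shows "symbol_dist s t \<le> 2 * (1/2) ^ m"
proof -
  let ?d = "\<lambda>i. (if s i = t i then 0 else 1) / 2 ^ i :: real"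
  have geo: "summable (\<lambda>i. (1/2) ^ i :: real)"
    by (rule summable_geometric) simp
  have sum: "summable ?d"
    by (rule summable_comparison_test'[OF geo, of 0]) (simp add: power_divide)
  have "symbol_dist s t = (\<Sum>i. ?d (i + m)) + (\<Sum>i<m. ?d i)"
    unfolding symbol_dist_def by (rule suminf_split_initial_segment[OF sum])
  also have "(\<Sum>i<m. ?d i) = 0"
    using assms by (intro sum.neutral) auto
  also have "(\<Sum>i. ?d (i + m)) \<le> (\<Sum>i. (1/2) ^ m * (1/2) ^ i)"
  proof (intro suminf_le summable_mult geo)
    show "summable (\<lambda>i. ?d (i + m))"
      using sum summable_iff_shift[of ?d m] by blast
  qed (auto simp: power_add power_divide mult.commute)
  also have "\<dots> = (1/2) ^ m * 2"
    by (simp add: suminf_mult[OF geo] suminf_geometric)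
  finally show ?thesis
    by simp
qed


section \<open>Sets with an itinerary\<close>

text \<open>The hypotheses of the theorem, fixed once; \<open>W i\<close> is the time-independent
  set \<open>V_i\<close> there.\<close>

locale coupled_system =
  fixes f :: "nat \<Rightarrow> 'a \<Rightarrow> 'a::metric_space"
    and A :: "real^'n^'n"
    and V :: "'n \<Rightarrow> nat \<Rightarrow> 'a set"
    and W :: "'n \<Rightarrow> 'a set"
  assumes compact_UNIV: "compact (UNIV :: 'a set)"
    and cont: "\<And>n. continuous_on UNIV (f n)"
    and equi: "equi_continuous_in dist dist (\<lambda>n. UNIV) f"
    and trans: "transition_matrix A"
    and V_nonempty: "\<And>i n. V i n \<noteq> {}"
    and V_closed: "\<And>i n. closed (V i n)"
    and W_closed: "\<And>i. closed (W i)"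
    and W_disjoint: "\<And>i j. i \<noteq> j \<Longrightarrow> W i \<inter> W j = {}"
    and V_subset: "\<And>i n. V i n \<subseteq> W i"
    and expanding: "weakly_coupled_expanding f A V"
begin

lemma V_covered: "A $ i $ j = 1 \<Longrightarrow> V j (Suc n) \<subseteq> f n ` V i n"
  using expanding unfolding weakly_coupled_expanding_def by blast

definition has_itinerary :: "nat \<Rightarrow> 'a set \<Rightarrow> (nat \<Rightarrow> 'n) \<Rightarrow> bool" where
  "has_itinerary n B s \<longleftrightarrow> B \<in> hyperspace \<and> (\<forall>k. iter f n k ` B \<subseteq> V (s k) (n + k))"

text \<open>The description is justified by \<open>has_itinerary_unique\<close> for sets that have
  an itinerary; other values are unspecified.\<close>

definition itinerary :: "nat \<Rightarrow> 'a set \<Rightarrow> nat \<Rightarrow> 'n" where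
  "itinerary n B = (THE s. has_itinerary n B s)"

definition itinerary_sets :: "nat \<Rightarrow> 'a set set" where
  "itinerary_sets n = {B. \<exists>s\<in>subshift A. has_itinerary n B s}"

lemma has_itinerary_at_0:
  assumes "has_itinerary n B s"
  shows "B \<subseteq> V (s 0) n"
proof -
  have "iter f n 0 ` B \<subseteq> V (s 0) (n + 0)"
    using assms unfolding has_itinerary_def by blast
  then show ?thesis
    by simp
qed

lemma W_unique:
  assumes "C \<subseteq> W i" "C \<subseteq> W j" "C \<noteq> {}"
  shows "i = j"
  using assms W_disjoint[of i j] by blast

lemma has_itinerary_unique:
  assumes "has_itinerary n B s" "has_itinerary n B t"
  shows "s = t"
proof
  fix k
  have "iter f n k ` B \<subseteq> W (s k)" "iter f n k ` B \<subseteq> W (t k)" "B \<noteq> {}"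
    using assms V_subset[of "s k" "n + k"] V_subset[of "t k" "n + k"]
    unfolding has_itinerary_def hyperspace_def by blast+
  then show "s k = t k"
    using W_unique image_is_empty by metis
qed

lemma itinerary_eq: "has_itinerary n B s \<Longrightarrow> itinerary n B = s"
  unfolding itinerary_def using has_itinerary_unique by blast

lemma
  assumes "B \<in> itinerary_sets n"
  shows itinerary_in_subshift: "itinerary n B \<in> subshift A"
    and has_itinerary_itinerary: "has_itinerary n B (itinerary n B)"
proof -
  obtain s where "s \<in> subshift A" "has_itinerary n B s"
    using assms by (auto simp: itinerary_sets_def)
  then show "itinerary n B \<in> subshift A" "has_itinerary n B (itinerary n B)"
    using itinerary_eq by simp_all
qed

lemma itinerary_sets_hyperspace: "itinerary_sets n \<subseteq> hyperspace"
  by (auto simp: itinerary_sets_def has_itinerary_def)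

lemma iter_itinerary_subset_W:
  assumes "B \<in> itinerary_sets n"
  shows "iter f n k ` B \<subseteq> W (itinerary n B k)"
  using has_itinerary_itinerary[OF assms] V_subset[of "itinerary n B k" "n + k"]
  unfolding has_itinerary_def by blast

section \<open>Action of the maps on itineraries, and realization of every sequence\<close>

lemma has_itinerary_induced_map:
  assumes "has_itinerary n B s"
  shows "has_itinerary (Suc n) (induced_map f n B) (shift_map s)"
proof -
  have "iter f (Suc n) k ` f n ` B \<subseteq> V (s (Suc k)) (Suc n + k)" for k
  proof -
    have "iter f (Suc n) k ` f n ` B = iter f n (Suc k) ` B"
      unfolding image_image by (rule image_cong[OF refl iter_Suc_left[symmetric]])
    then show ?thesis
      using assms unfolding has_itinerary_def by (metis add_Suc_right add_Suc)
  qed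
  then show ?thesis
    using assms induced_map_hyperspace[of f n, OF cont]
    by (auto simp: has_itinerary_def shift_map_def induced_map_def)
qed

text \<open>A point for the shifted sequence at time \<open>Suc n\<close> is pulled back by
  \<open>V_covered\<close>. The induction thus runs backwards in time, and \<open>n\<close> and
  \<open>s\<close> have to vary.\<close>

lemma orbit_segment_exists:
  assumes "s \<in> subshift A"
  shows "\<exists>x. \<forall>k\<le>m. iter f n k x \<in> V (s k) (n + k)"
  using assms
proof (induction m arbitrary: n s)
  case 0
  then show ?case
    using V_nonempty[of "s 0" n] by auto
next
  case (Suc m)
  obtain y where y: "\<forall>k\<le>m. iter f (Suc n) k y \<in> V (shift_map s k) (Suc n + k)"
    using Suc.IH[OF shift_map_in_subshift[OF Suc.prems]] by blast
  then have "y \<in> V (s 1) (Suc n)"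
    by (auto simp: shift_map_def dest: spec[of _ 0])
  moreover have "A $ s 0 $ s 1 = 1"
    using Suc.prems by (auto simp: subshift_def)
  ultimately obtain x where x: "x \<in> V (s 0) n" "y = f n x"
    using V_covered by blast
  have "iter f n k x \<in> V (s k) (n + k)" if "k \<le> Suc m" for k
  proof (cases k)
    case 0
    then show ?thesis
      using x by simp
  next
    case (Suc l)
    then show ?thesis
      using y x(2) that by (simp add: iter_Suc_left shift_map_def del: iter.simps)
  qed
  then show ?case
    by blast
qed

lemma closed_iter_vimage:
  assumes "closed K"
  shows "closed (iter f n k -` K)"
  using continuous_on_iter[of f, OF cont] assms by (simp add: closed_vimage continuous_on_eq_continuous_at)

text \<open>The closed sets \<open>?K k\<close> have the finite intersection property by
  \<open>orbit_segment_exists\<close>, so compactness yields a point following all of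
  \<open>s\<close>. The set of all such points is itself compact and serves as
  \<open>B\<close>.\<close>

lemma has_itinerary_exists:
  assumes "s \<in> subshift A"
  obtains B where "has_itinerary n B s"
proof -
  let ?K = "\<lambda>k. iter f n k -` V (s k) (n + k)"
  have "UNIV \<inter> (\<Inter>k\<in>UNIV. ?K k) \<noteq> {}"
  proof (rule compact_imp_fip_image[OF compact_UNIV])
    fix I :: "nat set" assume "finite I"
    then obtain m where "\<forall>k\<in>I. k \<le> m"
      using finite_nat_set_iff_bounded_le by blast
    then show "UNIV \<inter> (\<Inter>k\<in>I. ?K k) \<noteq> {}"
      using orbit_segment_exists[OF assms, of m n] by blast
  qed (simp add: closed_iter_vimage V_closed)
  moreover have "closed (\<Inter>k. ?K k)"
    by (simp add: closed_INT closed_iter_vimage V_closed)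
  ultimately have "has_itinerary n (\<Inter>k. ?K k) s"
    by (auto simp: has_itinerary_def hyperspace_UNIV_iff[OF compact_UNIV])
  then show ?thesis
    by (rule that)
qed

lemma itinerary_surj: "itinerary n ` itinerary_sets n = subshift A"
proof (intro equalityI subsetI)
  fix s assume s: "s \<in> subshift A"
  then obtain B where "has_itinerary n B s"
    by (rule has_itinerary_exists)
  then show "s \<in> itinerary n ` itinerary_sets n"
    using s itinerary_eq by (force simp: itinerary_sets_def)
qed (auto intro: itinerary_in_subshift)

lemma itinerary_sets_nonempty: "itinerary_sets n \<noteq> {}"
  using subshift_starting_at[OF trans] itinerary_surj[of n] by (metis empty_iff image_is_empty)

lemma itinerary_induced_map:
  assumes "B \<in> itinerary_sets n"
  shows "itinerary (Suc n) (induced_map f n B) = shift_map (itinerary n B)"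
  by (rule itinerary_eq[OF has_itinerary_induced_map[OF has_itinerary_itinerary[OF assms]]])

lemma iter_itinerary:
  assumes "B \<in> itinerary_sets 0"
  shows "iter (induced_map f) 0 k B \<subseteq> W (itinerary 0 B k)"
  using iter_itinerary_subset_W[OF assms] by (simp add: iter_induced_map)

lemma induced_map_itinerary_sets: "induced_map f n ` itinerary_sets n = itinerary_sets (Suc n)"
proof (intro equalityI subsetI)
  fix B assume "B \<in> induced_map f n ` itinerary_sets n"
  then show "B \<in> itinerary_sets (Suc n)"
    using has_itinerary_induced_map shift_map_in_subshift by (force simp: itinerary_sets_def)
next
  fix B assume "B \<in> itinerary_sets (Suc n)"
  then obtain t where t: "t \<in> subshift A" "has_itinerary (Suc n) B t"
    by (auto simp: itinerary_sets_def)
  obtain i where i: "A $ i $ t 0 = 1"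
    using transition_matrix_predecessor[OF trans] .
  \<comment> \<open>\<open>B\<close> lies in \<open>V (t 0) (Suc n)\<close>, which is covered by
    \<open>f n\<close> applied to \<open>V i n\<close>; hence this part of the preimage is mapped
    onto all of \<open>B\<close>.\<close>
  define B' where "B' = V i n \<inter> f n -` B"
  have B: "closed B" "B \<noteq> {}" "B \<subseteq> V (t 0) (Suc n)"
    using t(2) hyperspace_UNIV_iff[OF compact_UNIV, of B] has_itinerary_at_0[OF t(2)]
    by (auto simp: has_itinerary_def)
  then have image: "f n ` B' = B"
    using V_covered[OF i, of n] unfolding B'_def by blast
  have "closed (f n -` B)"
    using cont[of n] B(1) by (simp add: closed_vimage continuous_on_eq_continuous_at)
  then have "B' \<in> hyperspace"
    using image B(2) V_closed by (auto simp: hyperspace_UNIV_iff[OF compact_UNIV] B'_def)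
  moreover have "iter f n k ` B' \<subseteq> V (case_nat i t k) (n + k)" for k
  proof (cases k)
    case 0
    then show ?thesis
      by (simp add: B'_def)
  next
    case (Suc l)
    have "iter f n k ` B' = iter f (Suc n) l ` f n ` B'"
      unfolding image_image Suc by (rule image_cong[OF refl iter_Suc_left])
    then show ?thesis
      using t(2) Suc by (simp add: image has_itinerary_def)
  qed
  ultimately have "B' \<in> itinerary_sets n"
    using case_nat_in_subshift[OF t(1) i] by (auto simp: itinerary_sets_def has_itinerary_def)
  then show "B \<in> induced_map f n ` itinerary_sets n"
    using image by (force simp: induced_map_def)
qed

section \<open>Location and compactness of the itinerary sets\<close>

lemma itinerary_sets_subset: "itinerary_sets n \<subseteq> (\<Union>i. subsets_in_hyperspace (V i n))"
proof
  fix B assume "B \<in> itinerary_sets n"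
  then obtain s where "has_itinerary n B s"
    by (auto simp: itinerary_sets_def)
  then have "B \<in> subsets_in_hyperspace (V (s 0) n)"
    using has_itinerary_at_0 by (simp add: subsets_in_hyperspace_def has_itinerary_def)
  then show "B \<in> (\<Union>i. subsets_in_hyperspace (V i n))"
    by blast
qed

text \<open>Having an itinerary in the subshift is a condition on pairs of consecutive times, each of
  which allows finitely many choices of symbols.\<close>

lemma itinerary_sets_eq:
  "itinerary_sets n = (\<Inter>k. \<Union>(i, j)\<in>{(i, j). A $ i $ j = 1}.
     subsets_in_hyperspace (iter f n k -` V i (n + k)) \<inter>
     subsets_in_hyperspace (iter f n (Suc k) -` V j (n + Suc k)))" (is "_ = ?R")
proof (intro equalityI subsetI)
  fix B assume "B \<in> itinerary_sets n"
  then obtain s where "s \<in> subshift A" "has_itinerary n B s"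
    by (auto simp: itinerary_sets_def)
  then have "\<forall>k. A $ s k $ s (Suc k) = 1 \<and>
      B \<in> subsets_in_hyperspace (iter f n k -` V (s k) (n + k))"
    by (simp add: subshift_def has_itinerary_def subsets_in_hyperspace_def image_subset_iff_subset_vimage)
  then show "B \<in> ?R"
    by blast
next
  fix B assume "B \<in> ?R"
  then have "\<forall>k. \<exists>i j. A $ i $ j = 1 \<and>
     B \<in> subsets_in_hyperspace (iter f n k -` V i (n + k)) \<and>
     B \<in> subsets_in_hyperspace (iter f n (Suc k) -` V j (n + Suc k))"
    by blast
  then obtain s t where st: "A $ s k $ t k = 1"
     "B \<in> subsets_in_hyperspace (iter f n k -` V (s k) (n + k))"
     "B \<in> subsets_in_hyperspace (iter f n (Suc k) -` V (t k) (n + Suc k))" for k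
    by metis
  have B: "B \<in> hyperspace" and s: "iter f n k ` B \<subseteq> V (s k) (n + k)"
    and t: "iter f n (Suc k) ` B \<subseteq> V (t k) (n + Suc k)" for k
    using st by (auto simp: subsets_in_hyperspace_def image_subset_iff_subset_vimage simp del: iter.simps)
  \<comment> \<open>The symbol for time \<open>Suc k\<close> is chosen twice, at stage
    \<open>k\<close> and at stage \<open>Suc k\<close>. Both choices agree by disjointness, which
    glues the pairs into one sequence.\<close>
  have "t k = s (Suc k)" for k
  proof (rule W_unique)
    show "iter f n (Suc k) ` B \<subseteq> W (t k)" "iter f n (Suc k) ` B \<subseteq> W (s (Suc k))"
      using t s V_subset by (meson order_trans)+
    show "iter f n (Suc k) ` B \<noteq> {}"
      using B by (simp add: hyperspace_def)
  qed
  then have "s \<in> subshift A"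
    using st(1) by (simp add: subshift_def)
  then show "B \<in> itinerary_sets n"
    using B s by (auto simp: itinerary_sets_def has_itinerary_def)
qed

lemma compactin_itinerary_sets: "compactin hyperspace_topology (itinerary_sets n)"
proof (rule closedin_compact_space[OF compact_space_hyperspace[OF compact_UNIV]])
  \<comment> \<open>Closedness passes to the inner union because it is finite; a union over all
    sequences of the subshift would not allow this argument.\<close>
  have "finite {(i, j). A $ i $ j = 1}"
    by (rule finite_subset[OF subset_UNIV]) simp
  then show "closedin hyperspace_topology (itinerary_sets n)"
    unfolding itinerary_sets_eq
    by (intro closedin_Inter)
      (auto intro!: closedin_Union closedin_Int closedin_subsets_in_hyperspace closed_iter_vimage V_closed
        simp del: iter.simps)
qed

section \<open>The equi-semiconjugacy and the entropy bound\<close>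

lemma W_separated:
  obtains \<delta> where "\<delta> > 0" "\<And>i j x y. x \<in> W i \<Longrightarrow> y \<in> W j \<Longrightarrow> dist x y < \<delta> \<Longrightarrow> i = j"
proof -
  \<comment> \<open>The open set \<open>U i\<close> avoids every \<open>W j\<close> except
    \<open>W i\<close>; as the \<open>W j\<close> are disjoint, these sets cover the space.\<close>
  define U where "U i = - (\<Union>j\<in>-{i}. W j)" for i
  have U_unique: "k = i" if "x \<in> W k" "x \<in> U i" for x k i
    using that by (auto simp: U_def)
  have "open (U i)" for i
    unfolding U_def by (intro open_Compl closed_UN) (auto simp: W_closed)
  then have openU: "open C" if "C \<in> range U" for C
    using that by blast
  have coverU: "UNIV \<subseteq> \<Union>(range U)"
  proof
    fix x
    show "x \<in> \<Union>(range U)"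
    proof (cases "\<exists>k. x \<in> W k")
      case True
      then obtain k where k: "x \<in> W k" ..
      then have "x \<notin> W j" if "j \<noteq> k" for j
        using W_disjoint[OF that] by blast
      then have "x \<in> U k"
        by (auto simp: U_def)
      then show ?thesis
        by blast
    qed (simp add: U_def)
  qed
  \<comment> \<open>A Lebesgue number of the cover: two points closer than \<open>\<delta>\<close>
    lie in a common \<open>U k\<close>, and the only set \<open>W j\<close> that meets it can be
    \<open>W k\<close>.\<close>
  obtain \<delta> where \<delta>: "\<delta> > 0" "\<forall>x\<in>UNIV. \<exists>C\<in>range U. ball x \<delta> \<subseteq> C"
    using Heine_Borel_lemma[OF compact_UNIV coverU openU] by metis
  have "i = j" if x: "x \<in> W i" "y \<in> W j" "dist x y < \<delta>" for x y i j
  proof -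
    obtain k where "ball x \<delta> \<subseteq> U k"
      using \<delta>(2) by (metis UNIV_I imageE)
    then have "x \<in> U k" "y \<in> U k"
      using x(3) \<delta>(1) by auto
    then show ?thesis
      using U_unique x(1,2) by metis
  qed
  with \<delta>(1) show ?thesis
    by (rule that)
qed

text \<open>One pair of nearby points of \<open>B\<close> and \<open>C\<close> suffices: after
  \<open>k\<close> steps the points are still too close to lie in different sets \<open>W i\<close>.
  Equi-continuity makes the radius independent of \<open>n\<close>, though not of
  \<open>k\<close>.\<close>

lemma itinerary_locally_constant:
  "\<exists>r>0. \<forall>n. \<forall>B\<in>itinerary_sets n. \<forall>C\<in>itinerary_sets n. hausdorff_dist B C < r \<longrightarrow>
     itinerary n B k = itinerary n C k"
proof -
  obtain \<delta> where \<delta>: "\<delta> > 0" "\<And>i j x y. x \<in> W i \<Longrightarrow> y \<in> W j \<Longrightarrow> dist x y < \<delta> \<Longrightarrow> i = j"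
    using W_separated by blast
  obtain r where r: "r > 0" "\<And>n x y. dist x y < r \<Longrightarrow> dist (iter f n k x) (iter f n k y) < \<delta>"
    using equi_continuous_in_iter[OF equi, of k] \<delta>(1) unfolding equi_continuous_in_def by (metis UNIV_I)
  have "itinerary n B k = itinerary n C k"
    if B: "B \<in> itinerary_sets n" and C: "C \<in> itinerary_sets n" and d: "hausdorff_dist B C < r" for n B C
  proof -
    have hyp: "B \<in> hyperspace" "C \<in> hyperspace"
      using B C itinerary_sets_hyperspace by auto
    then obtain b where b: "b \<in> B"
      by (auto simp: hyperspace_def)
    then obtain c where c: "c \<in> C" "dist b c < r"
      using hausdorff_dist_less_nearby_point[OF hyp d] by blast
    have "iter f n k b \<in> W (itinerary n B k)" "iter f n k c \<in> W (itinerary n C k)"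
      using iter_itinerary_subset_W B C b c(1) by blast+
    then show ?thesis
      using \<delta>(2) r(2)[OF c(2)] by blast
  qed
  with r(1) show ?thesis
    by blast
qed

lemma equi_continuous_itinerary:
  "equi_continuous_in hausdorff_dist symbol_dist itinerary_sets itinerary"
  unfolding equi_continuous_in_def
proof (intro allI impI)
  fix e :: real assume "e > 0"
  then obtain m where m: "(1/2) ^ m < e / 2"
    using real_arch_pow_inv[of "e/2" "1/2"] by auto
  obtain r where r: "r k > 0" "B \<in> itinerary_sets n \<Longrightarrow> C \<in> itinerary_sets n \<Longrightarrow>
      hausdorff_dist B C < r k \<Longrightarrow> itinerary n B k = itinerary n C k" for k n B C
    using itinerary_locally_constant by metis
  \<comment> \<open>Only the first \<open>m\<close> symbols have to agree, so finitely many radii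
    are involved; the inserted 1 covers the case \<open>m = 0\<close>.\<close>
  define \<delta> where "\<delta> = Min (insert 1 (r ` {..<m}))"
  have \<delta>: "\<delta> > 0" "\<And>k. k < m \<Longrightarrow> \<delta> \<le> r k"
    using r(1) by (auto simp: \<delta>_def)
  have "symbol_dist (itinerary n B) (itinerary n C) < e"
    if "B \<in> itinerary_sets n" "C \<in> itinerary_sets n" "hausdorff_dist B C < \<delta>" for n B C
  proof -
    have "symbol_dist (itinerary n B) (itinerary n C) \<le> 2 * (1/2) ^ m"
      using r(2) that \<delta>(2) by (intro symbol_dist_le) force
    with m show ?thesis
      by simp
  qed
  with \<delta>(1) show "\<exists>\<delta>>0. \<forall>n. \<forall>B\<in>itinerary_sets n. \<forall>C\<in>itinerary_sets n.
      hausdorff_dist B C < \<delta> \<longrightarrow> symbol_dist (itinerary n B) (itinerary n C) < e"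
    by blast
qed

lemma equi_semiconjugate_itinerary_sets:
  "equi_semiconjugate hausdorff_dist itinerary_sets (induced_map f) symbol_dist (subshift A) shift_map"
  unfolding equi_semiconjugate_def
proof (intro exI conjI)
  show "\<forall>n. itinerary n ` itinerary_sets n = subshift A"
    using itinerary_surj by (rule allI)
  show "equi_continuous_in hausdorff_dist symbol_dist itinerary_sets itinerary"
    by (rule equi_continuous_itinerary)
  show "\<forall>n. \<forall>B\<in>itinerary_sets n. itinerary (Suc n) (induced_map f n B) = shift_map (itinerary n B)"
    using itinerary_induced_map by blast
qed

text \<open>An element of the \<open>n\<close>-th join of this cover contains only sets of \<open>itinerary_sets 0\<close> with one
  and the same word of length \<open>n\<close>.\<close>

definition coding_cover :: "'a set set set" where
  "coding_cover = range (\<lambda>i. hyperspace - (\<Union>j\<in>-{i}. subsets_in_hyperspace (W j)))"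

lemma open_cover_coding: "open_cover hyperspace_topology coding_cover"
  unfolding open_cover_def
proof
  have "closedin hyperspace_topology (\<Union>j\<in>-{i}. subsets_in_hyperspace (W j))" for i
  proof (rule closedin_Union)
    show "finite ((\<lambda>j. subsets_in_hyperspace (W j)) ` (-{i}))"
      by (rule finite_imageI) (rule finite)
  qed (blast intro: closedin_subsets_in_hyperspace W_closed)
  then have "openin hyperspace_topology (hyperspace - (\<Union>j\<in>-{i}. subsets_in_hyperspace (W j)))" for i
    using openin_diff[OF openin_topspace] by (metis topspace_hyperspace)
  then show "\<forall>U\<in>coding_cover. openin hyperspace_topology U"
    by (simp add: coding_cover_def)
  show "\<Union>coding_cover = topspace hyperspace_topology"
  proof
    show "topspace hyperspace_topology \<subseteq> \<Union>coding_cover"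
    proof
      fix B assume "B \<in> topspace (hyperspace_topology :: 'a set topology)"
      then have B: "B \<in> hyperspace"
        by simp
      show "B \<in> \<Union>coding_cover"
      proof (cases "\<exists>i. B \<subseteq> W i")
        case True
        then obtain i where i: "B \<subseteq> W i" ..
        have "j = i" if "B \<subseteq> W j" for j
          using W_unique[OF that i] B by (auto simp: hyperspace_def)
        then show ?thesis
          using B by (force simp: coding_cover_def subsets_in_hyperspace_def)
      qed (use B in \<open>auto simp: coding_cover_def subsets_in_hyperspace_def\<close>)
    qed
  qed (auto simp: coding_cover_def)
qed

text \<open>The cover element with index \<open>k\<close> omits all sets inside any other
  \<open>W l\<close>, so both indices equal \<open>k\<close>.\<close>

lemma coding_cover_unique:
  assumes "U \<in> coding_cover" "B \<in> U" "C \<in> U" "B \<subseteq> W i" "C \<subseteq> W j"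
  shows "i = j"
proof -
  obtain k where U: "U = hyperspace - (\<Union>j\<in>-{k}. subsets_in_hyperspace (W j))"
    using assms(1) by (auto simp: coding_cover_def)
  have "l = k" if "D \<in> U" "D \<subseteq> W l" for D l
    using that unfolding U subsets_in_hyperspace_def by blast
  then show ?thesis
    using assms(2-5) by metis
qed

lemma card_words_le_min_subcover:
  "card (words A n) \<le> min_subcover
    (restrict_cover (join_cover hyperspace_topology (induced_map f) coding_cover n) (itinerary_sets 0))
    (itinerary_sets 0)"
proof (rule min_subcover_ge)
  let ?J = "join_cover hyperspace_topology (induced_map f) coding_cover n"
  let ?Y = "itinerary_sets 0"
  have "finite coding_cover"
    by (simp add: coding_cover_def)
  then show "finite (restrict_cover ?J ?Y)"
    by (simp add: restrict_cover_def finite_join_cover)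
  have "induced_map f k ` hyperspace \<subseteq> hyperspace" for k
    using induced_map_hyperspace[of f k, OF cont] by blast
  then have "hyperspace \<subseteq> \<Union>?J"
    using join_cover_covers[OF open_cover_coding, of "induced_map f" n] by simp
  then show "?Y \<subseteq> \<Union>(restrict_cover ?J ?Y)"
    using itinerary_sets_hyperspace[of 0] by (auto simp: restrict_cover_def)
  fix \<D> assume \<D>: "\<D> \<subseteq> restrict_cover ?J ?Y" "finite \<D>" "?Y \<subseteq> \<Union>\<D>"
  have same: "prefix n (itinerary 0 B) = prefix n (itinerary 0 C)"
    if D: "D \<in> \<D>" "B \<in> D" "C \<in> D" for D B C
  proof -
    obtain J where "J \<in> ?J" "D = J \<inter> ?Y"
      using \<D>(1) D(1) by (auto simp: restrict_cover_def)
    then obtain U where U: "\<forall>k<n. U k \<in> coding_cover"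
        "D = {B \<in> hyperspace. \<forall>k<n. iter (induced_map f) 0 k B \<in> U k} \<inter> ?Y"
      by (auto simp: join_cover_def)
    show ?thesis
      unfolding prefix_eq_iff
    proof (intro allI impI)
      fix k assume "k < n"
      then show "itinerary 0 B k = itinerary 0 C k"
        using U D(2,3) by (intro coding_cover_unique[OF _ _ _ iter_itinerary iter_itinerary]) auto
    qed
  qed
  \<comment> \<open>By \<open>same\<close> all members of \<open>D\<close> carry one word, so an
    arbitrary member labels \<open>D\<close>. Every word is such a label, because every sequence of
    the subshift is an itinerary and \<open>\<D>\<close> covers.\<close>
  have "words A n \<subseteq> (\<lambda>D. prefix n (itinerary 0 (SOME B. B \<in> D))) ` \<D>"
  proof
    fix w assume "w \<in> words A n"
    then obtain B where B: "B \<in> ?Y" "w = prefix n (itinerary 0 B)"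
      unfolding words_def itinerary_surj[of 0, symmetric] by blast
    then obtain D where D: "D \<in> \<D>" "B \<in> D"
      using \<D>(3) by blast
    then have "w = prefix n (itinerary 0 (SOME B. B \<in> D))"
      unfolding B(2) by (metis same someI)
    with D(1) show "w \<in> (\<lambda>D. prefix n (itinerary 0 (SOME B. B \<in> D))) ` \<D>"
      by blast
  qed
  then show "card (words A n) \<le> card \<D>"
    by (rule surj_card_le[OF \<D>(2)])
qed

lemma entropy_itinerary_sets:
  "ereal (ln (growth_rate A)) \<le> topological_entropy hyperspace_topology (induced_map f) (itinerary_sets 0)"
  by (rule topological_entropy_ge[OF open_cover_coding card_words_pos[OF trans]
        card_words_le_min_subcover words_growth_rate[OF trans]])

end

theorem theorem4p5:
  fixes f :: "nat \<Rightarrow> 'a \<Rightarrow> 'a::metric_space"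
    and A :: "real^'n^'n"
    and V :: "'n \<Rightarrow> nat \<Rightarrow> 'a set"
    and W :: "'n \<Rightarrow> 'a set"
  assumes "compact (UNIV :: 'a set)"
    and "\<And>n. continuous_on UNIV (f n)"
    and "equi_continuous_in dist dist (\<lambda>n. UNIV) f"
    and "transition_matrix A"
    and "\<And>i n. V i n \<noteq> {}"
    and "\<And>i n. closed (V i n)"
    and "\<And>i. closed (W i)"
    and "\<And>i j. i \<noteq> j \<Longrightarrow> W i \<inter> W j = {}"
    and "\<And>i n. V i n \<subseteq> W i"
    and "weakly_coupled_expanding f A V"
  shows "\<exists>\<C> :: nat \<Rightarrow> 'a set set.
    (\<forall>n. \<C> n \<noteq> {} \<and> compactin hyperspace_topology (\<C> n) \<and>
         \<C> n \<subseteq> (\<Union>i. subsets_in_hyperspace (V i n)) \<and>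
         induced_map f n ` \<C> n = \<C> (Suc n)) \<and>
    equi_semiconjugate hausdorff_dist \<C> (induced_map f) symbol_dist (subshift A) shift_map \<and>
    topological_entropy hyperspace_topology (induced_map f) (\<C> 0) \<ge> ereal (ln (growth_rate A))"
proof -
  interpret coupled_system f A V W
    by unfold_locales (fact assms)+
  show ?thesis
    using itinerary_sets_nonempty compactin_itinerary_sets itinerary_sets_subset
      induced_map_itinerary_sets equi_semiconjugate_itinerary_sets entropy_itinerary_sets
    by (intro exI[of _ itinerary_sets]) simp
qed

end
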